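(* Let $\gamma\in[0,1]$, $S^k_\gamma:=Gx^k-\gamma Gx^{k-1}$, and let $\widetilde S^k_\gamma$ be generated by the loopless-SVRG estimator described in the context, with batch size $b$ and snapshot probability $\mathbf{p}\in(0,1)$. For $k\ge0$ let $$\Delta_k:=\frac1{nb}\sum_{i=1}^n\mathbb{E}\big[\|G_ix^k-\gamma G_ix^{k-1}-(1-\gamma)G_iw^k\|^2\big],$$ and $\Delta_{-1}:=0$. Then $\widetilde S^k_\gamma$ is a stochastic unbiased variance-reduced estimator of $S^k_\gamma$ with this sequence $\{\Delta_k\}$ and the constants $$\rho:=\frac{\mathbf{p}}2,\qquad C:=\frac{4-6\mathbf{p}+3\mathbf{p}^2}{b\mathbf{p}},\qquad\hat C:=\frac{2\gamma^2(2-3\mathbf{p}+\mathbf{p}^2)}{b\mathbf{p}};$$ that is, for all $k\ge0$: $\mathbb{E}_k[\widetilde S^k_\gamma-S^k_\gamma]=0$, $\ \mathbb{E}[\|\widetilde S^k_\gamma-S^k_\gamma\|^2]\le\Delta_k$, and $\Delta_k\le(1-\rho)\Delta_{k-1}+C\,U_k+\hat C\,U_{k-1}$, where $U_k:=\frac1n\sum_{i=1}^n\mathbb{E}[\|G_ix^k-G_ix^{k-1}\|^2]$.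
   Context: $G=\frac1n\sum_{i=1}^nG_i$ with $G_i:\mathbb{R}^p\to\mathbb{R}^p$; norms are Euclidean; $x^0$ is deterministic and $x^{-1}=x^{-2}:=x^0$. $\mathbb{E}_k[\cdot]:=\mathbb{E}[\cdot\mid\sigma(x^0,\dots,x^k)]$. Loopless-SVRG estimator. Put $w^0:=x^0$. At each iteration $k\ge0$, a mini-batch $\mathcal{B}_k\subseteq\{1,\dots,n\}$ of fixed size $b$ is drawn uniformly at random, independently of everything generated before (in particular of $x^0,\dots,x^k,w^0,\dots,w^k$); with $G_{\mathcal{B}_k}z:=\frac1b\sum_{i\in\mathcal{B}_k}G_iz$ one sets $$\widetilde S^k_\gamma:=(1-\gamma)\big(Gw^k-G_{\mathcal{B}_k}w^k\big)+G_{\mathcal{B}_k}x^k-\gamma G_{\mathcal{B}_k}x^{k-1}.$$ Then $x^{k+1}$ is computed from the quantities available so far (including $\widetilde S^k_\gamma$), and, by an independent coin flip, $w^{k+1}:=x^k$ with probability $\mathbf{p}$ and $w^{k+1}:=w^k$ with probability $1-\mathbf{p}$. *)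

theory Defs
  imports "HOL-Probability.Probability"
begin

text \<open>
  Iterations are indexed by \<^typ>\<open>int\<close>, so that \<open>x (- 1)\<close> and \<open>x (- 2)\<close> are literally available;
  batches, coins and snapshots are only constrained at indices \<open>\<ge> 0\<close>.
\<close>

definition avg_op :: "nat \<Rightarrow> (nat \<Rightarrow> real^'d \<Rightarrow> real^'d) \<Rightarrow> real^'d \<Rightarrow> real^'d" where
  "avg_op n G z = (1 / real n) *\<^sub>R (\<Sum>i\<in>{1..n}. G i z)"

definition batch_op :: "nat \<Rightarrow> (nat \<Rightarrow> real^'d \<Rightarrow> real^'d) \<Rightarrow> nat set \<Rightarrow> real^'d \<Rightarrow> real^'d" where
  "batch_op b G I z = (1 / real b) *\<^sub>R (\<Sum>i\<in>I. G i z)"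

definition batches :: "nat \<Rightarrow> nat \<Rightarrow> nat set set" where
  "batches n b = {I. I \<subseteq> {1..n} \<and> card I = b}"

definition S_target ::
  "nat \<Rightarrow> (nat \<Rightarrow> real^'d \<Rightarrow> real^'d) \<Rightarrow> real \<Rightarrow> (int \<Rightarrow> 'a \<Rightarrow> real^'d) \<Rightarrow> int \<Rightarrow> 'a \<Rightarrow> real^'d" where
  "S_target n G \<gamma> x k \<omega> = avg_op n G (x k \<omega>) - \<gamma> *\<^sub>R avg_op n G (x (k - 1) \<omega>)"

definition S_svrg ::
  "nat \<Rightarrow> nat \<Rightarrow> (nat \<Rightarrow> real^'d \<Rightarrow> real^'d) \<Rightarrow> real \<Rightarrow> (int \<Rightarrow> 'a \<Rightarrow> real^'d) \<Rightarrow> (int \<Rightarrow> 'a \<Rightarrow> real^'d)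
    \<Rightarrow> (int \<Rightarrow> 'a \<Rightarrow> nat set) \<Rightarrow> int \<Rightarrow> 'a \<Rightarrow> real^'d" where
  "S_svrg n b G \<gamma> x w B k \<omega> =
     (1 - \<gamma>) *\<^sub>R (avg_op n G (w k \<omega>) - batch_op b G (B k \<omega>) (w k \<omega>))
     + batch_op b G (B k \<omega>) (x k \<omega>) - \<gamma> *\<^sub>R batch_op b G (B k \<omega>) (x (k - 1) \<omega>)"

definition gen_by :: "'a measure \<Rightarrow> 'b measure \<Rightarrow> ('a \<Rightarrow> 'b) \<Rightarrow> 'a set set" where
  "gen_by M N X = sets (vimage_algebra (space M) X N)"

definition iterate_algebra :: "'a measure \<Rightarrow> (int \<Rightarrow> 'a \<Rightarrow> real^'d) \<Rightarrow> int \<Rightarrow> 'a measure" where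
  "iterate_algebra M x k = sigma (space M) (\<Union>j\<in>{0..k}. gen_by M borel (x j))"

text \<open>Everything generated before the batch of iteration \<open>k\<close> is drawn.\<close>

definition pre_batch_algebra ::
  "'a measure \<Rightarrow> (int \<Rightarrow> 'a \<Rightarrow> real^'d) \<Rightarrow> (int \<Rightarrow> 'a \<Rightarrow> real^'d) \<Rightarrow> (int \<Rightarrow> 'a \<Rightarrow> nat set)
    \<Rightarrow> (int \<Rightarrow> 'a \<Rightarrow> bool) \<Rightarrow> int \<Rightarrow> 'a measure" where
  "pre_batch_algebra M x w B c k = sigma (space M)
     ((\<Union>j\<in>{0..k}. gen_by M borel (x j) \<union> gen_by M borel (w j)) \<union>
      (\<Union>j\<in>{0..<k}. gen_by M (count_space UNIV) (B j) \<union> gen_by M (count_space UNIV) (c j)))"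

text \<open>Everything generated before the coin of iteration \<open>k\<close> is flipped, including \<open>x (k + 1)\<close>.\<close>

definition pre_coin_algebra ::
  "'a measure \<Rightarrow> (int \<Rightarrow> 'a \<Rightarrow> real^'d) \<Rightarrow> (int \<Rightarrow> 'a \<Rightarrow> real^'d) \<Rightarrow> (int \<Rightarrow> 'a \<Rightarrow> nat set)
    \<Rightarrow> (int \<Rightarrow> 'a \<Rightarrow> bool) \<Rightarrow> int \<Rightarrow> 'a measure" where
  "pre_coin_algebra M x w B c k = sigma (space M)
     (sets (pre_batch_algebra M x w B c k) \<union> gen_by M (count_space UNIV) (B k) \<union>
      gen_by M borel (x (k + 1)))"

text \<open>
  The function \<open>\<Phi>\<close> is an arbitrary update rule: it computes \<open>x (k + 1)\<close> from all quantities
  available when the batch of iteration \<open>k\<close> has been drawn. Hence, \<open>x 0\<close> being deterministic,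
  each iterate takes finitely many values, and no measurability or moment condition on
  the operators \<open>G i\<close> is needed for the expectations below to be finite.
\<close>

locale loopless_svrg = prob_space M
  for M :: "'a measure" +
  fixes n b :: nat
    and G :: "nat \<Rightarrow> real^'d \<Rightarrow> real^'d"
    and \<gamma> p :: real
    and x0 :: "real^'d"
    and \<Phi> :: "int \<Rightarrow> (real^'d) list \<Rightarrow> (real^'d) list \<Rightarrow> nat set list \<Rightarrow> bool list
                \<Rightarrow> (real^'d) list \<Rightarrow> real^'d"
    and x w :: "int \<Rightarrow> 'a \<Rightarrow> real^'d"
    and B :: "int \<Rightarrow> 'a \<Rightarrow> nat set"
    and c :: "int \<Rightarrow> 'a \<Rightarrow> bool"
  assumes batch_size: "1 \<le> b" "b \<le> n"
    and init: "\<And>\<omega>. \<omega> \<in> space M \<Longrightarrow> x 0 \<omega> = x0"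
              "\<And>\<omega>. \<omega> \<in> space M \<Longrightarrow> x (- 1) \<omega> = x0"
              "\<And>\<omega>. \<omega> \<in> space M \<Longrightarrow> x (- 2) \<omega> = x0"
              "\<And>\<omega>. \<omega> \<in> space M \<Longrightarrow> w 0 \<omega> = x0"
    and batch_rv: "\<And>k. k \<ge> 0 \<Longrightarrow> B k \<in> M \<rightarrow>\<^sub>M count_space (batches n b)"
    and batch_uniform: "\<And>k. k \<ge> 0 \<Longrightarrow>
          distr M (count_space (batches n b)) (B k) = uniform_count_measure (batches n b)"
    and batch_indep: "\<And>k. k \<ge> 0 \<Longrightarrow>
          indep_set (gen_by M (count_space UNIV) (B k)) (sets (pre_batch_algebra M x w B c k))"
    and x_step: "\<And>k \<omega>. k \<ge> 0 \<Longrightarrow> \<omega> \<in> space M \<Longrightarrow>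
          x (k + 1) \<omega> = \<Phi> k (map (\<lambda>j. x j \<omega>) [0..k]) (map (\<lambda>j. w j \<omega>) [0..k])
            (map (\<lambda>j. B j \<omega>) [0..k]) (map (\<lambda>j. c j \<omega>) [0..k - 1])
            (map (\<lambda>j. S_svrg n b G \<gamma> x w B j \<omega>) [0..k])"
    and coin_rv: "\<And>k. k \<ge> 0 \<Longrightarrow> c k \<in> M \<rightarrow>\<^sub>M count_space UNIV"
    and coin_bernoulli: "\<And>k. k \<ge> 0 \<Longrightarrow>
          distr M (count_space UNIV) (c k) = measure_pmf (bernoulli_pmf p)"
    and coin_indep: "\<And>k. k \<ge> 0 \<Longrightarrow>
          indep_set (gen_by M (count_space UNIV) (c k)) (sets (pre_coin_algebra M x w B c k))"
    and w_step: "\<And>k \<omega>. k \<ge> 0 \<Longrightarrow> \<omega> \<in> space M \<Longrightarrow>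
          w (k + 1) \<omega> = (if c k \<omega> then x k \<omega> else w k \<omega>)"

definition \<Delta>_svrg ::
  "'a measure \<Rightarrow> nat \<Rightarrow> nat \<Rightarrow> (nat \<Rightarrow> real^'d \<Rightarrow> real^'d) \<Rightarrow> real \<Rightarrow> (int \<Rightarrow> 'a \<Rightarrow> real^'d)
    \<Rightarrow> (int \<Rightarrow> 'a \<Rightarrow> real^'d) \<Rightarrow> int \<Rightarrow> real" where
  "\<Delta>_svrg M n b G \<gamma> x w k =
     (if k < 0 then 0 else 1 / (real n * real b) *
        (\<Sum>i\<in>{1..n}. \<integral>\<omega>. (norm (G i (x k \<omega>) - \<gamma> *\<^sub>R G i (x (k - 1) \<omega>)
                                    - (1 - \<gamma>) *\<^sub>R G i (w k \<omega>)))\<^sup>2 \<partial>M))"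

definition U_diff ::
  "'a measure \<Rightarrow> nat \<Rightarrow> (nat \<Rightarrow> real^'d \<Rightarrow> real^'d) \<Rightarrow> (int \<Rightarrow> 'a \<Rightarrow> real^'d) \<Rightarrow> int \<Rightarrow> real" where
  "U_diff M n G x k =
     1 / real n * (\<Sum>i\<in>{1..n}. \<integral>\<omega>. (norm (G i (x k \<omega>) - G i (x (k - 1) \<omega>)))\<^sup>2 \<partial>M)"

text \<open>The library's conditional expectation is real-valued; here it is taken componentwise.\<close>

definition vec_cond_exp :: "'a measure \<Rightarrow> 'a measure \<Rightarrow> ('a \<Rightarrow> real^'d) \<Rightarrow> 'a \<Rightarrow> real^'d" where
  "vec_cond_exp M F f \<omega> = (\<chi> j. real_cond_exp M F (\<lambda>\<omega>'. f \<omega>' $ j) \<omega>)"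

text \<open>
  The two integrability clauses exclude the default values that the library gives to
  expectations of non-integrable functions.
\<close>

definition unbiased_variance_reduced ::
  "'a measure \<Rightarrow> nat \<Rightarrow> (nat \<Rightarrow> real^'d \<Rightarrow> real^'d) \<Rightarrow> real \<Rightarrow> (int \<Rightarrow> 'a \<Rightarrow> real^'d)
    \<Rightarrow> (int \<Rightarrow> 'a \<Rightarrow> real^'d) \<Rightarrow> (int \<Rightarrow> real) \<Rightarrow> real \<Rightarrow> real \<Rightarrow> real \<Rightarrow> bool" where
  "unbiased_variance_reduced M n G \<gamma> x St \<Delta> \<rho> C C' \<longleftrightarrow>
     (\<forall>k\<ge>0.
        integrable M (\<lambda>\<omega>. St k \<omega> - S_target n G \<gamma> x k \<omega>) \<and>
        (AE \<omega> in M. vec_cond_exp M (iterate_algebra M x k)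
                        (\<lambda>\<omega>'. St k \<omega>' - S_target n G \<gamma> x k \<omega>') \<omega> = 0) \<and>
        integrable M (\<lambda>\<omega>. (norm (St k \<omega> - S_target n G \<gamma> x k \<omega>))\<^sup>2) \<and>
        (\<integral>\<omega>. (norm (St k \<omega> - S_target n G \<gamma> x k \<omega>))\<^sup>2 \<partial>M) \<le> \<Delta> k \<and>
        \<Delta> k \<le> (1 - \<rho>) * \<Delta> (k - 1) + C * U_diff M n G x k + C' * U_diff M n G x (k - 1))"

end

theory Submission
  imports Defs
begin

text \<open>
  Put \<open>y i = G i (x k) - \<gamma> *\<^sub>R G i (x (k - 1)) - (1 - \<gamma>) *\<^sub>R G i (w k)\<close>. The estimation error
  of iteration \<open>k\<close> is exactly the mean of the \<open>y i\<close> over the batch minus their mean over all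
  indices. The batch is uniform and independent of the \<open>y i\<close>, so expectations of functions of
  the error may be computed by averaging over all batches (\<open>expectation_over_batch\<close>), which
  leaves two finite facts about sampling without replacement: the average error vanishes
  (\<open>batch_mean_unbiased\<close>), and the average squared error is at most \<open>1 / (n * b)\<close> times the sum
  of the \<open>(norm (y i))\<^sup>2\<close> (\<open>batch_mean_variance\<close>), the expectation of which is \<open>\<Delta> k\<close>.
  Unbiasedness even holds given the whole past, and hence given the coarser algebra of the iterates.

  For the recursion, the coin of iteration \<open>m\<close> is independent of everything in
  \<open>\<Delta> (m + 1)\<close> except the choice of \<open>w (m + 1)\<close> (\<open>coin_expectation\<close>). With probability \<open>p\<close> the
  snapshot is \<open>x m\<close>, and the vector \<open>y i\<close> collapses to \<open>G i (x (m + 1)) - G i (x m)\<close>. Otherwise the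
  snapshot is stale, and \<open>y i\<close> differs from its predecessor by
  \<open>G i (x (m + 1)) - G i (x m)\<close> minus \<open>\<gamma>\<close> times \<open>G i (x m) - G i (x (m - 1))\<close>; Young's inequality,
  tuned so that \<open>1 - p\<close> grows to only \<open>1 - p / 2\<close>, gives the contraction
  (\<open>stale_snapshot_bound\<close>).

  Measurability and integrability come from the finite range of all iterates
  (\<open>finite_range_iterates\<close>): composed with an arbitrary \<open>G i\<close>, they remain simple functions.
\<close>

section \<open>Averages over all batches\<close>

lemma card_batches_containing:
  assumes "T \<subseteq> {1..n}" "card T \<le> b"
  shows "card {I \<in> batches n b. T \<subseteq> I} = (n - card T) choose (b - card T)"
proof -
  have fT: "finite T" using assms(1) finite_subset by blast
  have "bij_betw (\<lambda>J. J \<union> T) {J. J \<subseteq> {1..n} - T \<and> card J = b - card T} {I \<in> batches n b. T \<subseteq> I}"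
  proof (rule bij_betw_byWitness[where f' = "\<lambda>I. I - T"])
    show "(\<lambda>J. J \<union> T) ` {J. J \<subseteq> {1..n} - T \<and> card J = b - card T} \<subseteq> {I \<in> batches n b. T \<subseteq> I}"
    proof clarify
      fix J assume J: "J \<subseteq> {1..n} - T" "card J = b - card T"
      have "finite J" using J(1) finite_subset by blast
      moreover have "J \<inter> T = {}" using J(1) by blast
      ultimately have "card (J \<union> T) = b" using J(2) fT assms(2) by (simp add: card_Un_disjoint)
      then show "J \<union> T \<in> batches n b \<and> T \<subseteq> J \<union> T" using J(1) assms(1) by (auto simp: batches_def)
    qed
    show "(\<lambda>I. I - T) ` {I \<in> batches n b. T \<subseteq> I} \<subseteq> {J. J \<subseteq> {1..n} - T \<and> card J = b - card T}"
      using fT by (auto simp: batches_def card_Diff_subset)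
  qed auto
  then have "card {I \<in> batches n b. T \<subseteq> I} = card {J. J \<subseteq> {1..n} - T \<and> card J = b - card T}"
    by (simp add: bij_betw_same_card)
  also have "\<dots> = (n - card T) choose (b - card T)"
    using assms(1) fT by (simp add: n_subsets card_Diff_subset)
  finally show ?thesis .
qed

lemma finite_batches: "finite (batches n b)"
  by (rule finite_subset[of _ "Pow {1..n}"]) (auto simp: batches_def)

lemma card_batches: "card (batches n b) = n choose b"
  by (simp add: batches_def n_subsets)

lemma sum_over_batches:
  fixes y :: "nat \<Rightarrow> 'v::real_vector"
  assumes "1 \<le> b"
  shows "(\<Sum>I\<in>batches n b. \<Sum>i\<in>I. y i) = real ((n - 1) choose (b - 1)) *\<^sub>R (\<Sum>i\<in>{1..n}. y i)"
proof -
  have "(\<Sum>I\<in>batches n b. \<Sum>i\<in>I. y i) = (\<Sum>I\<in>batches n b. \<Sum>i | i \<in> {1..n} \<and> i \<in> I. y i)"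
    by (intro sum.cong refl) (auto simp: batches_def)
  also have "\<dots> = (\<Sum>i\<in>{1..n}. \<Sum>I | I \<in> batches n b \<and> i \<in> I. y i)"
    by (rule sum.swap_restrict) (auto simp: finite_batches)
  also have "\<dots> = (\<Sum>i\<in>{1..n}. real ((n - 1) choose (b - 1)) *\<^sub>R y i)"
  proof (intro sum.cong refl)
    fix i assume "i \<in> {1..n}"
    then show "(\<Sum>I | I \<in> batches n b \<and> i \<in> I. y i) = real ((n - 1) choose (b - 1)) *\<^sub>R y i"
      using card_batches_containing[of "{i}" n b] assms by (simp add: sum_constant_scaleR)
  qed
  finally show ?thesis by (simp add: scaleR_sum_right)
qed

lemma batch_count_ratio:
  assumes "1 \<le> b" "b \<le> n"
  shows "real b * real (n choose b) = real n * real ((n - 1) choose (b - 1))"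
  using times_binomial_minus1_eq[of b n] assms by (metis of_nat_mult less_le_trans zero_less_one)

lemma batch_mean_unbiased:
  fixes y :: "nat \<Rightarrow> 'v::real_vector"
  assumes "1 \<le> b" "b \<le> n"
  shows "(\<Sum>I\<in>batches n b. (1 / real b) *\<^sub>R (\<Sum>i\<in>I. y i) - (1 / real n) *\<^sub>R (\<Sum>i\<in>{1..n}. y i)) = 0"
proof -
  have "real ((n - 1) choose (b - 1)) / real b = real (n choose b) / real n"
    using batch_count_ratio[OF assms] assms by (simp add: field_simps)
  then show ?thesis
    by (simp add: sum_subtractf scaleR_sum_right[symmetric] sum_over_batches[OF assms(1)]
        sum_constant_scaleR card_batches)
qed

text \<open>
  Expand the square: every index lies in the same number of batches, and so does every pair of
  distinct indices. As the \<open>u i\<close> sum to zero, the cross terms add up to a nonpositive quantity.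
\<close>

lemma sum_norm_sq_centered_batches:
  fixes u :: "nat \<Rightarrow> 'v::real_inner"
  assumes b: "1 \<le> b" and centered: "(\<Sum>i\<in>{1..n}. u i) = 0"
  shows "(\<Sum>I\<in>batches n b. (norm (\<Sum>i\<in>I. u i))\<^sup>2)
    \<le> real ((n - 1) choose (b - 1)) * (\<Sum>i\<in>{1..n}. (norm (u i))\<^sup>2)"
proof -
  define m1 where "m1 = real ((n - 1) choose (b - 1))"
  define m2 where "m2 = (if 2 \<le> b then real ((n - 2) choose (b - 2)) else 0)"
  have count: "real (card {I \<in> batches n b. {i, j} \<subseteq> I}) = (if i = j then m1 else m2)"
    if "i \<in> {1..n}" "j \<in> {1..n}" for i j
  proof (cases "i = j")
    case True
    then show ?thesis using that b card_batches_containing[of "{i}" n b] by (simp add: m1_def)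
  next
    case False
    show ?thesis
    proof (cases "2 \<le> b")
      case True
      then show ?thesis using that False card_batches_containing[of "{i, j}" n b]
        by (simp add: m2_def numeral_2_eq_2)
    next
      case b1: False
      have "{I \<in> batches n b. {i, j} \<subseteq> I} = {}"
      proof (rule ccontr)
        assume "{I \<in> batches n b. {i, j} \<subseteq> I} \<noteq> {}"
        then obtain I where "I \<subseteq> {1..n}" "card I = b" "{i, j} \<subseteq> I" by (auto simp: batches_def)
        then have "card {i, j} \<le> b" using card_mono finite_subset by (metis finite_atLeastAtMost)
        then show False using False b1 by simp
      qed
      then show ?thesis using b1 False by (simp only: m2_def card.empty if_False of_nat_0)
    qed
  qed
  have "(\<Sum>I\<in>batches n b. (norm (\<Sum>i\<in>I. u i))\<^sup>2)
      = (\<Sum>I\<in>batches n b. \<Sum>q | q \<in> {1..n} \<times> {1..n} \<and> {fst q, snd q} \<subseteq> I. u (fst q) \<bullet> u (snd q))"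
  proof (intro sum.cong refl)
    fix I assume "I \<in> batches n b"
    then have I: "{q. q \<in> {1..n} \<times> {1..n} \<and> {fst q, snd q} \<subseteq> I} = I \<times> I"
      by (auto simp: batches_def)
    show "(norm (\<Sum>i\<in>I. u i))\<^sup>2
        = (\<Sum>q | q \<in> {1..n} \<times> {1..n} \<and> {fst q, snd q} \<subseteq> I. u (fst q) \<bullet> u (snd q))"
      unfolding I by (simp add: power2_norm_eq_inner inner_sum_left inner_sum_right
          sum.cartesian_product case_prod_beta inner_commute)
  qed
  also have "\<dots> = (\<Sum>q\<in>{1..n} \<times> {1..n}. \<Sum>I | I \<in> batches n b \<and> {fst q, snd q} \<subseteq> I. u (fst q) \<bullet> u (snd q))"
    by (rule sum.swap_restrict) (auto simp: finite_batches)
  also have "\<dots> = (\<Sum>q\<in>{1..n} \<times> {1..n}. (if fst q = snd q then m1 else m2) * (u (fst q) \<bullet> u (snd q)))"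
    by (intro sum.cong refl) (simp only: sum_constant count mem_Times_iff)
  also have "\<dots> = (\<Sum>i\<in>{1..n}. \<Sum>j\<in>{1..n}. (if i = j then m1 else m2) * (u i \<bullet> u j))"
    by (simp add: sum.cartesian_product case_prod_beta)
  also have "\<dots> = (\<Sum>i\<in>{1..n}. \<Sum>j\<in>{1..n}. (if i = j then (m1 - m2) * (u i \<bullet> u j) else 0) + m2 * (u i \<bullet> u j))"
    by (intro sum.cong refl) (auto simp: algebra_simps)
  also have "\<dots> = (m1 - m2) * (\<Sum>i\<in>{1..n}. (norm (u i))\<^sup>2)
      + m2 * ((\<Sum>i\<in>{1..n}. u i) \<bullet> (\<Sum>j\<in>{1..n}. u j))"
    by (simp add: sum.distrib sum_distrib_left inner_sum_left inner_sum_right power2_norm_eq_inner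
        inner_commute)
  also have "\<dots> \<le> m1 * (\<Sum>i\<in>{1..n}. (norm (u i))\<^sup>2)"
    unfolding centered by (simp add: m2_def mult_right_mono sum_nonneg)
  finally show ?thesis by (simp add: m1_def)
qed

text \<open>Centring the vectors at their mean can only decrease the sum of their squared norms.\<close>

lemma batch_mean_variance:
  fixes y :: "nat \<Rightarrow> 'v::real_inner"
  assumes bn: "1 \<le> b" "b \<le> n"
  shows "(\<Sum>I\<in>batches n b. (norm ((1 / real b) *\<^sub>R (\<Sum>i\<in>I. y i) - (1 / real n) *\<^sub>R (\<Sum>i\<in>{1..n}. y i)))\<^sup>2)
     / real (n choose b) \<le> 1 / (real n * real b) * (\<Sum>i\<in>{1..n}. (norm (y i))\<^sup>2)"
proof -
  define a where "a = (1 / real n) *\<^sub>R (\<Sum>i\<in>{1..n}. y i)"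
  define u where "u i = y i - a" for i
  have n: "real n *\<^sub>R a = (\<Sum>i\<in>{1..n}. y i)" using bn by (simp add: a_def)
  then have su: "(\<Sum>i\<in>{1..n}. u i) = 0"
    by (simp add: u_def sum_subtractf sum_constant_scaleR)
  have "(\<Sum>i\<in>{1..n}. (norm (y i))\<^sup>2)
      = (\<Sum>i\<in>{1..n}. (norm (u i))\<^sup>2 + 2 * (u i \<bullet> a) + (norm a)\<^sup>2)"
    by (intro sum.cong refl)
      (simp add: u_def power2_norm_eq_inner inner_diff_left inner_diff_right inner_commute)
  also have "\<dots> = (\<Sum>i\<in>{1..n}. (norm (u i))\<^sup>2) + 2 * ((\<Sum>i\<in>{1..n}. u i) \<bullet> a) + real n * (norm a)\<^sup>2"
    by (simp add: sum.distrib sum_distrib_left inner_sum_left)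
  finally have shrink: "(\<Sum>i\<in>{1..n}. (norm (u i))\<^sup>2) \<le> (\<Sum>i\<in>{1..n}. (norm (y i))\<^sup>2)"
    using su by simp
  have pos: "real (n choose b) > 0" using bn by simp
  have "(\<Sum>I\<in>batches n b. (norm ((1 / real b) *\<^sub>R (\<Sum>i\<in>I. y i) - a))\<^sup>2)
      = (\<Sum>I\<in>batches n b. (norm (\<Sum>i\<in>I. u i))\<^sup>2) / (real b)\<^sup>2"
    unfolding sum_divide_distrib
  proof (intro sum.cong refl)
    fix I assume "I \<in> batches n b"
    then have "(1 / real b) *\<^sub>R (\<Sum>i\<in>I. y i) - a = (1 / real b) *\<^sub>R (\<Sum>i\<in>I. u i)"
      using bn by (simp add: batches_def u_def sum_subtractf sum_constant_scaleR scaleR_diff_right)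
    then show "(norm ((1 / real b) *\<^sub>R (\<Sum>i\<in>I. y i) - a))\<^sup>2 = (norm (\<Sum>i\<in>I. u i))\<^sup>2 / (real b)\<^sup>2"
      by (simp add: power_divide)
  qed
  also have "\<dots> \<le> real ((n - 1) choose (b - 1)) * (\<Sum>i\<in>{1..n}. (norm (u i))\<^sup>2) / (real b)\<^sup>2"
    by (intro divide_right_mono sum_norm_sq_centered_batches bn su) simp
  also have "\<dots> = real (n choose b) * (1 / (real n * real b) * (\<Sum>i\<in>{1..n}. (norm (u i))\<^sup>2))"
  proof -
    have "real ((n - 1) choose (b - 1)) = real b * real (n choose b) / real n"
      using batch_count_ratio[OF bn] bn by (simp add: field_simps)
    then show ?thesis using bn by (simp add: field_simps power2_eq_square)
  qed
  also have "\<dots> \<le> real (n choose b) * (1 / (real n * real b) * (\<Sum>i\<in>{1..n}. (norm (y i))\<^sup>2))"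
    by (intro mult_left_mono shrink) auto
  finally show ?thesis using pos unfolding a_def by (simp add: field_simps)
qed

section \<open>Independent draws and finitely valued random variables\<close>

lemma finite_range_map:
  assumes "\<And>j. j \<in> set js \<Longrightarrow> finite (f j ` S)"
  shows "finite ((\<lambda>\<omega>. map (\<lambda>j. f j \<omega>) js) ` S)"
proof (rule finite_subset)
  show "(\<lambda>\<omega>. map (\<lambda>j. f j \<omega>) js) ` S \<subseteq> {ys. set ys \<subseteq> (\<Union>j\<in>set js. f j ` S) \<and> length ys = length js}"
    by fastforce
  show "finite {ys. set ys \<subseteq> (\<Union>j\<in>set js. f j ` S) \<and> length ys = length js}"
    by (rule finite_lists_length_eq) (use assms in auto)
qed

lemma finite_range_Pair:
  assumes "finite (f ` S)" "finite (g ` S)"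
  shows "finite ((\<lambda>\<omega>. (f \<omega>, g \<omega>)) ` S)"
  by (rule finite_subset[of _ "f ` S \<times> g ` S"]) (use assms in auto)

lemma gen_by_Pow: "gen_by M N X \<subseteq> Pow (space M)"
  unfolding gen_by_def using sets.space_closed[of "vimage_algebra (space M) X N"] by simp

text \<open>
  A finite range makes preimages of points enough, so that arbitrary functions of such variables,
  measurable or not, are simple again.
\<close>

lemma simple_function_if_gen_by:
  fixes X :: "'a \<Rightarrow> 'b::t1_space"
  assumes "finite (X ` space M)" "gen_by M borel X \<subseteq> sets H" "space H = space M"
  shows "simple_function H X"
  unfolding simple_function_def
proof (intro conjI ballI)
  fix v
  have "X -` {v} \<inter> space M \<in> gen_by M borel X"
    unfolding gen_by_def by (rule in_vimage_algebra) simp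
  then show "X -` {v} \<inter> space H \<in> sets H" using assms(2,3) by auto
qed (use assms in auto)

lemma simple_function_subalgebra:
  assumes "simple_function H f" "subalgebra M H"
  shows "simple_function M f"
  using assms unfolding simple_function_def subalgebra_def by auto

lemma (in finite_measure) integrable_simple:
  fixes f :: "'a \<Rightarrow> 'b::{banach, second_countable_topology}"
  assumes "simple_function M f"
  shows "integrable M f"
  by (rule integrable_simple_function[OF assms]) simp

lemma (in prob_space) indep_set_sub_events: "indep_set S T \<Longrightarrow> S \<subseteq> events \<and> T \<subseteq> events"
  unfolding indep_set_def indep_sets_def by (auto simp: all_bool_eq UNIV_bool split: bool.splits)

text \<open>
  Expand \<open>Y\<close> over its finitely many level sets, each of which is independent of \<open>A\<close>.
\<close>

lemma (in prob_space) expectation_indicator_indep: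
  fixes Y :: "'a \<Rightarrow> real"
  assumes ind: "indep_set S (sets H)" and A: "A \<in> S"
    and sub: "subalgebra M H" and Y: "simple_function H Y"
  shows "(\<integral>\<omega>. indicator A \<omega> * Y \<omega> \<partial>M) = prob A * (\<integral>\<omega>. Y \<omega> \<partial>M)"
proof -
  define R where "R = Y ` space M"
  define L where "L v = Y -` {v} \<inter> space M" for v
  have sp: "space H = space M" using sub by (simp add: subalgebra_def)
  have fR: "finite R" using Y sp by (simp add: R_def simple_function_def)
  have LH: "L v \<in> sets H" for v
    using simple_functionD(2)[OF Y, of "{v}"] sp by (simp add: L_def)
  have A_ev: "A \<in> events" and L_ev: "L v \<in> events" for v
    using indep_set_sub_events[OF ind] A LH by auto
  have prod: "prob (A \<inter> L v) = prob A * prob (L v)" for v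
    using indep_setD[OF ind A LH] .
  have Yexp: "Y \<omega> = (\<Sum>v\<in>R. v * indicator (L v) \<omega>)" if "\<omega> \<in> space M" for \<omega>
  proof -
    have "(\<Sum>v\<in>R. v * indicator (L v) \<omega>) = (\<Sum>v\<in>R. if v = Y \<omega> then v else 0)"
      using that by (intro sum.cong refl) (auto simp: L_def indicator_def)
    also have "\<dots> = Y \<omega>" using that fR by (simp add: R_def)
    finally show ?thesis by simp
  qed
  have "(\<integral>\<omega>. indicator A \<omega> * Y \<omega> \<partial>M) = (\<integral>\<omega>. (\<Sum>v\<in>R. v * indicator (A \<inter> L v) \<omega>) \<partial>M)"
    by (rule Bochner_Integration.integral_cong) (auto simp: Yexp sum_distrib_left indicator_def)
  also have "\<dots> = (\<Sum>v\<in>R. v * prob (A \<inter> L v))"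
    using A_ev L_ev by (subst Bochner_Integration.integral_sum) (auto simp: less_top[symmetric])
  also have "\<dots> = prob A * (\<Sum>v\<in>R. v * prob (L v))"
    by (simp add: prod sum_distrib_left mult_ac)
  also have "(\<Sum>v\<in>R. v * prob (L v)) = (\<integral>\<omega>. (\<Sum>v\<in>R. v * indicator (L v) \<omega>) \<partial>M)"
    using L_ev by (subst Bochner_Integration.integral_sum) (auto simp: less_top[symmetric])
  also have "\<dots> = (\<integral>\<omega>. Y \<omega> \<partial>M)"
    by (rule Bochner_Integration.integral_cong) (auto simp: Yexp)
  finally show ?thesis .
qed

lemma norm_add_sq_Young:
  fixes u v :: "'v::real_normed_vector"
  assumes "s > 0"
  shows "(norm (u + v))\<^sup>2 \<le> (1 + s) * (norm u)\<^sup>2 + (1 + 1 / s) * (norm v)\<^sup>2"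
proof -
  have "(norm (u + v))\<^sup>2 \<le> (norm u + norm v)\<^sup>2"
    by (simp add: norm_triangle_ineq power_mono)
  moreover have "0 \<le> (s * norm u - norm v)\<^sup>2 / s" using assms by simp
  moreover have "(s * norm u - norm v)\<^sup>2 / s = s * (norm u)\<^sup>2 - 2 * norm u * norm v + (norm v)\<^sup>2 / s"
    using assms by (simp add: power2_eq_square field_simps)
  ultimately show ?thesis by (simp add: power2_sum algebra_simps)
qed

text \<open>
  One iteration with the snapshot kept: \<open>g1\<close>, \<open>g0\<close> and \<open>g'\<close> are the values of one operator at
  three consecutive iterates, the newest first, and \<open>h\<close> is its value at the snapshot. The
  factor \<open>1 - p\<close> is the probability of keeping it; half of the gap between \<open>1 - p\<close> and \<open>1\<close> is
  spent on Young's inequality.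
\<close>

lemma stale_snapshot_bound:
  fixes g1 g0 g' h :: "'v::real_normed_vector"
  assumes p: "0 < p" "p < 1"
  shows "(1 - p) * (norm (g1 - \<gamma> *\<^sub>R g0 - (1 - \<gamma>) *\<^sub>R h))\<^sup>2
    \<le> (1 - p / 2) * (norm (g0 - \<gamma> *\<^sub>R g' - (1 - \<gamma>) *\<^sub>R h))\<^sup>2
      + 2 * (1 - p) * (2 - p) / p * ((norm (g1 - g0))\<^sup>2 + \<gamma>\<^sup>2 * (norm (g0 - g'))\<^sup>2)"
proof -
  define u where "u = g0 - \<gamma> *\<^sub>R g' - (1 - \<gamma>) *\<^sub>R h"
  define v where "v = (g1 - g0) + (- \<gamma>) *\<^sub>R (g0 - g')"
  \<comment> \<open>the solution of \<open>(1 - p) * (1 + s) = 1 - p / 2\<close>\<close>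
  define s where "s = p / (2 * (1 - p))"
  have s: "s > 0" "(1 - p) * (1 + s) = 1 - p / 2" "1 + 1 / s = (2 - p) / p"
    using p by (simp_all add: s_def field_simps)
  have v: "(norm v)\<^sup>2 \<le> 2 * ((norm (g1 - g0))\<^sup>2 + \<gamma>\<^sup>2 * (norm (g0 - g'))\<^sup>2)"
    using norm_add_sq_Young[of 1 "g1 - g0" "(- \<gamma>) *\<^sub>R (g0 - g')"]
    by (simp add: v_def power_mult_distrib)
  have "(1 - p) * (norm (u + v))\<^sup>2 \<le> (1 - p) * ((1 + s) * (norm u)\<^sup>2 + (1 + 1 / s) * (norm v)\<^sup>2)"
    using p s(1) by (intro mult_left_mono norm_add_sq_Young) auto
  also have "\<dots> = (1 - p / 2) * (norm u)\<^sup>2 + (1 - p) * (2 - p) / p * (norm v)\<^sup>2"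
    unfolding s(2)[symmetric] s(3) by (simp add: algebra_simps)
  also have "\<dots> \<le> (1 - p / 2) * (norm u)\<^sup>2
      + (1 - p) * (2 - p) / p * (2 * ((norm (g1 - g0))\<^sup>2 + \<gamma>\<^sup>2 * (norm (g0 - g'))\<^sup>2))"
    using p by (intro add_left_mono mult_left_mono v) auto
  also have "(1 - p) * (2 - p) / p * (2 * ((norm (g1 - g0))\<^sup>2 + \<gamma>\<^sup>2 * (norm (g0 - g'))\<^sup>2))
      = 2 * (1 - p) * (2 - p) / p * ((norm (g1 - g0))\<^sup>2 + \<gamma>\<^sup>2 * (norm (g0 - g'))\<^sup>2)"
    by (simp only: times_divide_eq_left times_divide_eq_right mult_ac)
  finally have "(1 - p) * (norm (u + v))\<^sup>2 \<le> (1 - p / 2) * (norm u)\<^sup>2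
      + 2 * (1 - p) * (2 - p) / p * ((norm (g1 - g0))\<^sup>2 + \<gamma>\<^sup>2 * (norm (g0 - g'))\<^sup>2)" .
  moreover have "g1 - \<gamma> *\<^sub>R g0 - (1 - \<gamma>) *\<^sub>R h = u + v"
    by (simp add: u_def v_def algebra_simps)
  ultimately show ?thesis by (simp only: u_def[symmetric])
qed

section \<open>Bias and variance of the estimator\<close>

context loopless_svrg
begin

definition before_batch where "before_batch k = pre_batch_algebra M x w B c k"

definition anchored_diff where
  "anchored_diff k i \<omega> = G i (x k \<omega>) - \<gamma> *\<^sub>R G i (x (k - 1) \<omega>) - (1 - \<gamma>) *\<^sub>R G i (w k \<omega>)"

lemma batch_in: "k \<ge> 0 \<Longrightarrow> \<omega> \<in> space M \<Longrightarrow> B k \<omega> \<in> batches n b"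
  using batch_rv[of k] by (auto dest: measurable_space)

lemma finite_range_batch: "k \<ge> 0 \<Longrightarrow> finite (B k ` space M)"
  by (rule finite_subset[OF _ finite_batches[of n b]]) (auto simp: batch_in)

text \<open>
  Each update only reads finitely many finitely valued quantities: earlier iterates and snapshots,
  batches of \<open>{1..n}\<close>, coins, and estimators computed from these. The index \<open>-1\<close> is included
  because the estimator of iteration \<open>0\<close> refers to it.
\<close>

lemma finite_range_iterates:
  assumes "k \<ge> 0"
  shows "\<forall>j\<in>{-1..k}. finite (x j ` space M) \<and> (0 \<le> j \<longrightarrow> finite (w j ` space M))"
  using assms
proof (induction k rule: int_ge_induct)
  case base
  have "x 0 ` space M \<subseteq> {x0}" "x (-1) ` space M \<subseteq> {x0}" "w 0 ` space M \<subseteq> {x0}"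
    using init by auto
  then have "finite (x 0 ` space M)" "finite (x (-1) ` space M)" "finite (w 0 ` space M)"
    using finite_subset by blast+
  moreover have "{-1..0::int} = {-1, 0}" by auto
  ultimately show ?case by auto
next
  case (step k)
  have fx: "finite (x j ` space M)" if "-1 \<le> j" "j \<le> k" for j using step.IH that by auto
  have fw: "finite (w j ` space M)" if "0 \<le> j" "j \<le> k" for j using step.IH that by auto
  have fc: "finite (c j ` space M)" for j by (rule finite_subset[of _ UNIV]) auto
  have fS: "finite (S_svrg n b G \<gamma> x w B j ` space M)" if "0 \<le> j" "j \<le> k" for j
  proof -
    have "finite ((\<lambda>\<omega>. (x j \<omega>, x (j - 1) \<omega>, w j \<omega>, B j \<omega>)) ` space M)"
      using that by (intro finite_range_Pair fx fw finite_range_batch) auto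
    from finite_imageI[OF this, of "\<lambda>(z, z', v, I). (1 - \<gamma>) *\<^sub>R (avg_op n G v - batch_op b G I v)
        + batch_op b G I z - \<gamma> *\<^sub>R batch_op b G I z'"]
    show ?thesis by (simp add: S_svrg_def[abs_def] image_image)
  qed
  let ?history = "\<lambda>\<omega>. (map (\<lambda>j. x j \<omega>) [0..k], map (\<lambda>j. w j \<omega>) [0..k], map (\<lambda>j. B j \<omega>) [0..k],
    map (\<lambda>j. c j \<omega>) [0..k - 1], map (\<lambda>j. S_svrg n b G \<gamma> x w B j \<omega>) [0..k])"
  have "finite (?history ` space M)"
    by (intro finite_range_Pair finite_range_map fx fw fc fS finite_range_batch) auto
  from finite_imageI[OF this, of "\<lambda>(xs, ws, Bs, cs, Ss). \<Phi> k xs ws Bs cs Ss"]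
  have x1: "finite (x (k + 1) ` space M)"
    by (simp add: image_image x_step[OF step.hyps] cong: image_cong_simp)
  have "w (k + 1) ` space M \<subseteq> x k ` space M \<union> w k ` space M"
    using w_step[OF step.hyps] by auto
  then have w1: "finite (w (k + 1) ` space M)"
    by (rule finite_subset) (use fx[of k] fw[of k] step.hyps in auto)
  show ?case
  proof
    fix j assume "j \<in> {-1..k + 1}"
    then have "j = k + 1 \<or> j \<in> {-1..k}" by auto
    then show "finite (x j ` space M) \<and> (0 \<le> j \<longrightarrow> finite (w j ` space M))"
      using x1 w1 step.IH by blast
  qed
qed

lemma space_before_batch [simp]: "space (before_batch k) = space M"
  unfolding before_batch_def pre_batch_algebra_def by (rule space_measure_of) (intro Un_least UN_least gen_by_Pow)

lemma sets_before_batch: "sets (before_batch k) = sigma_sets (space M)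
     ((\<Union>j\<in>{0..k}. gen_by M borel (x j) \<union> gen_by M borel (w j)) \<union>
      (\<Union>j\<in>{0..<k}. gen_by M (count_space UNIV) (B j) \<union> gen_by M (count_space UNIV) (c j)))"
  unfolding before_batch_def pre_batch_algebra_def by (rule sets_measure_of) (intro Un_least UN_least gen_by_Pow)

lemma subalgebra_before_batch: "k \<ge> 0 \<Longrightarrow> subalgebra M (before_batch k)"
  using indep_set_sub_events[OF batch_indep[of k]] by (simp add: subalgebra_def before_batch_def[symmetric])

lemma simple_x_before_batch:
  assumes "k \<ge> 0" "-1 \<le> j" "j \<le> k"
  shows "simple_function (before_batch k) (x j)"
proof (cases "j = -1")
  case True
  then show ?thesis using init(2) simple_function_const[of "before_batch k" x0]
    by (subst simple_function_cong[where g = "\<lambda>_. x0"]) auto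
next
  case False
  then have "gen_by M borel (x j) \<subseteq> sets (before_batch k)"
    using assms unfolding sets_before_batch by (intro subsetI sigma_sets.Basic) auto
  then show ?thesis
    using finite_range_iterates[OF assms(1)] assms by (intro simple_function_if_gen_by[of _ M]) auto
qed

lemma simple_w_before_batch:
  assumes "0 \<le> j" "j \<le> k"
  shows "simple_function (before_batch k) (w j)"
proof -
  have "gen_by M borel (w j) \<subseteq> sets (before_batch k)"
    using assms unfolding sets_before_batch by (intro subsetI sigma_sets.Basic) auto
  then show ?thesis
    using finite_range_iterates[of k] assms by (intro simple_function_if_gen_by[of _ M]) auto
qed

lemma simple_anchored_diff:
  assumes "k \<ge> 0"
  shows "simple_function (before_batch k) (\<lambda>\<omega>. h (\<lambda>i. anchored_diff k i \<omega>))"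
proof -
  have "simple_function (before_batch k) (\<lambda>\<omega>. (x k \<omega>, x (k - 1) \<omega>, w k \<omega>))"
    using assms by (intro simple_function_Pair simple_x_before_batch simple_w_before_batch) auto
  from simple_function_compose1[OF this,
      of "\<lambda>(z, z', v). h (\<lambda>i. G i z - \<gamma> *\<^sub>R G i z' - (1 - \<gamma>) *\<^sub>R G i v)"]
  show ?thesis by (simp add: anchored_diff_def)
qed

lemma batch_event:
  "B k -` {I} \<inter> space M \<in> gen_by M (count_space UNIV) (B k)"
  unfolding gen_by_def by (rule in_vimage_algebra) simp

lemma prob_batch:
  assumes "k \<ge> 0" "I \<in> batches n b"
  shows "prob (B k -` {I} \<inter> space M) = 1 / real (n choose b)"
proof -
  have "prob (B k -` {I} \<inter> space M) = measure (distr M (count_space (batches n b)) (B k)) {I}"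
    using assms batch_rv by (subst measure_distr) auto
  also have "\<dots> = 1 / real (n choose b)"
    using assms finite_batches[of n b]
    by (simp add: batch_uniform measure_uniform_count_measure card_batches)
  finally show ?thesis .
qed

text \<open>
  Fubini for a uniform batch, with \<open>h I\<close> depending on the past only: split according to the value
  of the batch, and factor each term by independence.
\<close>

lemma expectation_over_batch:
  fixes h :: "nat set \<Rightarrow> 'a \<Rightarrow> real"
  assumes k: "k \<ge> 0" and h: "\<And>I. I \<in> batches n b \<Longrightarrow> simple_function (before_batch k) (h I)"
  shows "(\<integral>\<omega>. h (B k \<omega>) \<omega> \<partial>M) = (\<integral>\<omega>. (\<Sum>I\<in>batches n b. h I \<omega>) / real (n choose b) \<partial>M)"
proof -
  let ?E = "\<lambda>I. B k -` {I} \<inter> space M"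
  have expand: "h (B k \<omega>) \<omega> = (\<Sum>I\<in>batches n b. indicator (?E I) \<omega> * h I \<omega>)"
    if "\<omega> \<in> space M" for \<omega>
  proof -
    have "(\<Sum>I\<in>batches n b. indicator (?E I) \<omega> * h I \<omega>)
        = (\<Sum>I\<in>batches n b. if I = B k \<omega> then h I \<omega> else 0)"
      using that by (intro sum.cong refl) (auto simp: indicator_def)
    then show ?thesis using that k by (simp add: finite_batches batch_in)
  qed
  have ev: "?E I \<in> events" for I
    using indep_set_sub_events[OF batch_indep[OF k]] batch_event by blast
  have int: "integrable M (h I)" if "I \<in> batches n b" for I
    using h[OF that] simple_function_subalgebra[OF _ subalgebra_before_batch[OF k]] integrable_simple by blast
  have int': "integrable M (\<lambda>\<omega>. indicator (?E I) \<omega> * h I \<omega>)" if "I \<in> batches n b" for I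
    using integrable_real_mult_indicator[OF ev int[OF that]] by (simp add: mult.commute)
  have "(\<integral>\<omega>. h (B k \<omega>) \<omega> \<partial>M) = (\<Sum>I\<in>batches n b. \<integral>\<omega>. indicator (?E I) \<omega> * h I \<omega> \<partial>M)"
    using int' by (subst Bochner_Integration.integral_cong[OF refl expand]) auto
  also have "\<dots> = (\<Sum>I\<in>batches n b. prob (?E I) * (\<integral>\<omega>. h I \<omega> \<partial>M))"
    using batch_indep[OF k] subalgebra_before_batch[OF k] h
    by (intro sum.cong refl expectation_indicator_indep[of "gen_by M (count_space UNIV) (B k)" "before_batch k"]
        batch_event) (auto simp: before_batch_def)
  also have "\<dots> = (\<integral>\<omega>. (\<Sum>I\<in>batches n b. h I \<omega>) / real (n choose b) \<partial>M)"
    using int by (simp add: prob_batch[OF k] sum_divide_distrib)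
  finally show ?thesis .
qed

text \<open>The estimation error that iteration \<open>k\<close> would make with the batch \<open>I\<close>.\<close>

definition batch_error :: "int \<Rightarrow> nat set \<Rightarrow> 'a \<Rightarrow> real^'d" where
  "batch_error k I \<omega> = (1 / real b) *\<^sub>R (\<Sum>i\<in>I. anchored_diff k i \<omega>)
     - (1 / real n) *\<^sub>R (\<Sum>i\<in>{1..n}. anchored_diff k i \<omega>)"

text \<open>
  The full mean at the snapshot in the estimator and the target together supply the mean of the
  \<open>anchored_diff k i\<close> over all \<open>i\<close>; the batch terms supply their mean over the batch.
\<close>

lemma estimation_error:
  "S_svrg n b G \<gamma> x w B k \<omega> - S_target n G \<gamma> x k \<omega> = batch_error k (B k \<omega>) \<omega>"
proof -
  have sum_diff: "(\<Sum>i\<in>I. anchored_diff k i \<omega>) = (\<Sum>i\<in>I. G i (x k \<omega>)) - \<gamma> *\<^sub>R (\<Sum>i\<in>I. G i (x (k - 1) \<omega>))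
      - (1 - \<gamma>) *\<^sub>R (\<Sum>i\<in>I. G i (w k \<omega>))" for I
    by (simp only: anchored_diff_def sum_subtractf scaleR_sum_right)
  show ?thesis
    unfolding batch_error_def sum_diff S_svrg_def S_target_def avg_op_def batch_op_def
    by (simp add: algebra_simps diff_divide_distrib)
qed

lemma simple_batch_error: "k \<ge> 0 \<Longrightarrow> simple_function (before_batch k) (\<lambda>\<omega>. h (batch_error k I \<omega>))"
  unfolding batch_error_def by (rule simple_anchored_diff)

lemma integrable_batch_error:
  fixes h :: "real^'d \<Rightarrow> 'e::{banach, second_countable_topology}"
  assumes k: "k \<ge> 0"
  shows "integrable M (\<lambda>\<omega>. h (batch_error k (B k \<omega>) \<omega>))"
proof -
  have "simple_function M (B k)"
    using finite_range_batch[OF k] batch_event indep_set_sub_events[OF batch_indep[OF k]]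
    unfolding simple_function_def by blast
  moreover have "simple_function M (\<lambda>\<omega> i. anchored_diff k i \<omega>)"
    using simple_function_subalgebra[OF simple_anchored_diff[OF k, of "\<lambda>y. y"] subalgebra_before_batch[OF k]] .
  ultimately have "simple_function M (\<lambda>\<omega>. h (batch_error k (B k \<omega>) \<omega>))"
    unfolding batch_error_def by (rule simple_function_compose2[where h = "\<lambda>I y. h ((1 / real b) *\<^sub>R (\<Sum>i\<in>I. y i)
      - (1 / real n) *\<^sub>R (\<Sum>i\<in>{1..n}. y i))"])
  then show ?thesis by (rule integrable_simple)
qed

text \<open>
  An event \<open>A\<close> of the iterate algebra lies in the past of the batch, so its indicator is
  unaffected by averaging over the batch, and the integral of the error over \<open>A\<close> vanishes.
\<close>

lemma svrg_unbiased:
  assumes k: "k \<ge> 0"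
  shows "AE \<omega> in M. vec_cond_exp M (iterate_algebra M x k)
           (\<lambda>\<omega>'. S_svrg n b G \<gamma> x w B k \<omega>' - S_target n G \<gamma> x k \<omega>') \<omega> = 0"
proof -
  let ?F = "iterate_algebra M x k"
  have Fspace: "space ?F = space M"
    unfolding iterate_algebra_def by (rule space_measure_of) (intro Un_least UN_least gen_by_Pow)
  have "sets ?F = sigma_sets (space M) (\<Union>j\<in>{0..k}. gen_by M borel (x j))"
    unfolding iterate_algebra_def by (rule sets_measure_of) (intro Un_least UN_least gen_by_Pow)
  also have "\<dots> \<subseteq> sets (before_batch k)" unfolding sets_before_batch by (rule sigma_sets_mono') blast
  finally have FH: "sets ?F \<subseteq> sets (before_batch k)" .
  then have sub: "subalgebra M ?F"
    using subalgebra_before_batch[OF k] Fspace by (auto simp: subalgebra_def)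
  interpret finite_measure_subalgebra M ?F
    by unfold_locales (rule sub)
  have "AE \<omega> in M. real_cond_exp M ?F (\<lambda>\<omega>. batch_error k (B k \<omega>) \<omega> $ j) \<omega> = 0" for j
  proof (rule real_cond_exp_charact)
    show "integrable M (\<lambda>\<omega>. batch_error k (B k \<omega>) \<omega> $ j)"
      by (rule integrable_batch_error[OF k])
    fix A assume "A \<in> sets ?F"
    then have A: "A \<in> sets (before_batch k)" using FH by blast
    have s: "simple_function (before_batch k) (\<lambda>\<omega>. indicator A \<omega> * (batch_error k I \<omega> $ j))" for I
      using A by (intro simple_function_mult simple_batch_error[OF k] simple_function_indicator)
    have "(\<integral>\<omega>. indicator A \<omega> * (batch_error k (B k \<omega>) \<omega> $ j) \<partial>M)
        = (\<integral>\<omega>. (\<Sum>I\<in>batches n b. indicator A \<omega> * (batch_error k I \<omega> $ j)) / real (n choose b) \<partial>M)"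
      by (rule expectation_over_batch[OF k s])
    also have "\<dots> = 0"
    proof -
      have "(\<Sum>I\<in>batches n b. batch_error k I \<omega>) = 0" for \<omega>
        unfolding batch_error_def by (rule batch_mean_unbiased[OF batch_size])
      then have "(\<Sum>I\<in>batches n b. batch_error k I \<omega> $ j) = 0" for \<omega>
        by (simp only: sum_component[symmetric] zero_index)
      then show ?thesis by (simp add: sum_distrib_left[symmetric])
    qed
    finally show "set_lebesgue_integral M A (\<lambda>\<omega>. batch_error k (B k \<omega>) \<omega> $ j) = (\<integral>\<omega>\<in>A. 0 \<partial>M)"
      by (simp add: set_lebesgue_integral_def)
  qed auto
  then have "AE \<omega> in M. \<forall>j. real_cond_exp M ?F (\<lambda>\<omega>. batch_error k (B k \<omega>) \<omega> $ j) \<omega> = 0"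
    by (simp add: AE_all_countable)
  then show ?thesis
    unfolding vec_cond_exp_def estimation_error by (simp add: vec_eq_iff)
qed

lemma svrg_variance:
  assumes k: "k \<ge> 0"
  shows "integrable M (\<lambda>\<omega>. (norm (S_svrg n b G \<gamma> x w B k \<omega> - S_target n G \<gamma> x k \<omega>))\<^sup>2)"
    and "(\<integral>\<omega>. (norm (S_svrg n b G \<gamma> x w B k \<omega> - S_target n G \<gamma> x k \<omega>))\<^sup>2 \<partial>M) \<le> \<Delta>_svrg M n b G \<gamma> x w k"
proof -
  have int: "integrable M (\<lambda>\<omega>. h (\<lambda>i. anchored_diff k i \<omega>))" for h :: "_ \<Rightarrow> real"
    using simple_anchored_diff[OF k]
      simple_function_subalgebra[OF _ subalgebra_before_batch[OF k]] integrable_simple by blast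
  show "integrable M (\<lambda>\<omega>. (norm (S_svrg n b G \<gamma> x w B k \<omega> - S_target n G \<gamma> x k \<omega>))\<^sup>2)"
    unfolding estimation_error
    by (rule integrable_batch_error[OF k])
  have "(\<integral>\<omega>. (norm (S_svrg n b G \<gamma> x w B k \<omega> - S_target n G \<gamma> x k \<omega>))\<^sup>2 \<partial>M)
      = (\<integral>\<omega>. (\<Sum>I\<in>batches n b. (norm (batch_error k I \<omega>))\<^sup>2) / real (n choose b) \<partial>M)"
    unfolding estimation_error
    by (rule expectation_over_batch[OF k]) (rule simple_batch_error[OF k])
  also have "\<dots> \<le> (\<integral>\<omega>. 1 / (real n * real b) * (\<Sum>i\<in>{1..n}. (norm (anchored_diff k i \<omega>))\<^sup>2) \<partial>M)"
    unfolding batch_error_def by (intro integral_mono int batch_mean_variance batch_size)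
  also have "\<dots> = \<Delta>_svrg M n b G \<gamma> x w k"
  proof -
    have "integrable M (\<lambda>\<omega>. (norm (anchored_diff k i \<omega>))\<^sup>2)" for i
      using int[of "\<lambda>y. (norm (y i))\<^sup>2"] .
    then show ?thesis using k by (simp add: \<Delta>_svrg_def anchored_diff_def[symmetric])
  qed
  finally show "(\<integral>\<omega>. (norm (S_svrg n b G \<gamma> x w B k \<omega> - S_target n G \<gamma> x k \<omega>))\<^sup>2 \<partial>M)
      \<le> \<Delta>_svrg M n b G \<gamma> x w k" .
qed

section \<open>Contraction of the variance bound\<close>

definition before_coin where "before_coin k = pre_coin_algebra M x w B c k"

lemma space_before_coin [simp]: "space (before_coin k) = space M"
  unfolding before_coin_def pre_coin_algebra_def before_batch_def[symmetric]
  by (rule space_measure_of)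
    (use sets.space_closed[of "before_batch k"] in \<open>auto intro!: Un_least gen_by_Pow simp del: sets.space_closed\<close>)

lemma sets_before_coin: "sets (before_coin k) = sigma_sets (space M)
     (sets (before_batch k) \<union> gen_by M (count_space UNIV) (B k) \<union> gen_by M borel (x (k + 1)))"
  unfolding before_coin_def pre_coin_algebra_def before_batch_def[symmetric]
  by (rule sets_measure_of)
    (use sets.space_closed[of "before_batch k"] in \<open>auto intro!: Un_least gen_by_Pow simp del: sets.space_closed\<close>)

lemma subalgebra_before_coin: "k \<ge> 0 \<Longrightarrow> subalgebra M (before_coin k)"
  using indep_set_sub_events[OF coin_indep[of k]] by (simp add: subalgebra_def before_coin_def[symmetric])

lemma before_batch_le_before_coin: "subalgebra (before_coin k) (before_batch k)"
  unfolding subalgebra_def sets_before_coin by auto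

lemma simple_x_before_coin:
  assumes "k \<ge> 0" "-1 \<le> j" "j \<le> k + 1"
  shows "simple_function (before_coin k) (x j)"
proof (cases "j = k + 1")
  case True
  have "gen_by M borel (x j) \<subseteq> sets (before_coin k)"
    unfolding sets_before_coin True by auto
  then show ?thesis
    using finite_range_iterates[of "k + 1"] assms by (intro simple_function_if_gen_by[of _ M]) auto
next
  case False
  then show ?thesis using assms
    by (intro simple_function_subalgebra[OF simple_x_before_batch before_batch_le_before_coin]) auto
qed

lemma simple_w_before_coin: "k \<ge> 0 \<Longrightarrow> simple_function (before_coin k) (w k)"
  by (intro simple_function_subalgebra[OF simple_w_before_batch before_batch_le_before_coin]) auto

text \<open>Write the choice as \<open>Q\<close> plus the indicator of heads times \<open>P - Q\<close>.\<close>

lemma coin_expectation: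
  fixes P Q :: "'a \<Rightarrow> real"
  assumes k: "k \<ge> 0" and p: "0 \<le> p" "p \<le> 1"
    and P: "simple_function (before_coin k) P" and Q: "simple_function (before_coin k) Q"
  shows "(\<integral>\<omega>. (if c k \<omega> then P \<omega> else Q \<omega>) \<partial>M) = p * (\<integral>\<omega>. P \<omega> \<partial>M) + (1 - p) * (\<integral>\<omega>. Q \<omega> \<partial>M)"
proof -
  let ?C = "c k -` {True} \<inter> space M"
  have C: "?C \<in> gen_by M (count_space UNIV) (c k)"
    unfolding gen_by_def by (rule in_vimage_algebra) simp
  have C_ev: "?C \<in> events" using indep_set_sub_events[OF coin_indep[OF k]] C by blast
  have int: "integrable M P" "integrable M Q"
    using P Q simple_function_subalgebra[OF _ subalgebra_before_coin[OF k]] integrable_simple by blast+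
  then have int': "integrable M (\<lambda>\<omega>. indicator ?C \<omega> * (P \<omega> - Q \<omega>))"
    using integrable_real_mult_indicator[OF C_ev, of "\<lambda>\<omega>. P \<omega> - Q \<omega>"] by (simp add: mult.commute)
  have pC: "prob ?C = p"
  proof -
    have "prob ?C = measure (distr M (count_space UNIV) (c k)) {True}"
      using coin_rv[OF k] by (subst measure_distr) auto
    then show ?thesis using p by (simp add: coin_bernoulli[OF k] measure_pmf_single)
  qed
  have "(\<integral>\<omega>. (if c k \<omega> then P \<omega> else Q \<omega>) \<partial>M) = (\<integral>\<omega>. indicator ?C \<omega> * (P \<omega> - Q \<omega>) + Q \<omega> \<partial>M)"
    by (rule Bochner_Integration.integral_cong) auto
  also have "\<dots> = (\<integral>\<omega>. indicator ?C \<omega> * (P \<omega> - Q \<omega>) \<partial>M) + (\<integral>\<omega>. Q \<omega> \<partial>M)"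
    using int int' by simp
  also have "(\<integral>\<omega>. indicator ?C \<omega> * (P \<omega> - Q \<omega>) \<partial>M) = p * (\<integral>\<omega>. P \<omega> - Q \<omega> \<partial>M)"
    using expectation_indicator_indep[OF coin_indep[OF k] C, folded before_coin_def, OF subalgebra_before_coin[OF k],
        of "\<lambda>\<omega>. P \<omega> - Q \<omega>"] P Q pC by simp
  finally show ?thesis using int by (simp add: algebra_simps)
qed

lemma \<Delta>_recursion:
  assumes p: "0 < p" "p < 1" and m: "m \<ge> 0"
  shows "\<Delta>_svrg M n b G \<gamma> x w (m + 1) \<le> (1 - p / 2) * \<Delta>_svrg M n b G \<gamma> x w m
      + (4 - 6 * p + 3 * p\<^sup>2) / (real b * p) * U_diff M n G x (m + 1)
      + 2 * \<gamma>\<^sup>2 * (2 - 3 * p + p\<^sup>2) / (real b * p) * U_diff M n G x m"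
proof -
  define D where "D k i \<omega> = (norm (G i (x k \<omega>) - G i (x (k - 1) \<omega>)))\<^sup>2" for k i \<omega>
  \<comment> \<open>\<open>D\<close> is what remains after a snapshot update, \<open>Q\<close> what remains when the snapshot is kept\<close>
  define Q where "Q i \<omega> = (norm (G i (x (m + 1) \<omega>) - \<gamma> *\<^sub>R G i (x m \<omega>)
      - (1 - \<gamma>) *\<^sub>R G i (w m \<omega>)))\<^sup>2" for i \<omega>
  define C where "C = 2 * (1 - p) * (2 - p) / p"
  have D_K: "simple_function (before_coin m) (D k i)" if "0 \<le> k" "k \<le> m + 1" for k i
    unfolding D_def[abs_def] using m that
    by (intro simple_function_compose2[of "before_coin m" "x k" "x (k - 1)" "\<lambda>z z'. (norm (G i z - G i z'))\<^sup>2"]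
        simple_x_before_coin) auto
  have Q_K: "simple_function (before_coin m) (Q i)" for i
  proof -
    have "simple_function (before_coin m) (\<lambda>\<omega>. (x (m + 1) \<omega>, x m \<omega>, w m \<omega>))"
      using m by (intro simple_function_Pair simple_x_before_coin simple_w_before_coin) auto
    from simple_function_compose1[OF this,
        of "\<lambda>(z, z', v). (norm (G i z - \<gamma> *\<^sub>R G i z' - (1 - \<gamma>) *\<^sub>R G i v))\<^sup>2"]
    show ?thesis by (simp add: Q_def[abs_def])
  qed
  have int_K: "simple_function (before_coin m) f \<Longrightarrow> integrable M f" for f :: "_ \<Rightarrow> real"
    using simple_function_subalgebra[OF _ subalgebra_before_coin[OF m]] integrable_simple by blast
  have int_diff: "integrable M (\<lambda>\<omega>. (norm (anchored_diff m i \<omega>))\<^sup>2)" for i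
    using simple_anchored_diff[OF m, of "\<lambda>y. (norm (y i))\<^sup>2"] simple_function_subalgebra[OF _ subalgebra_before_batch[OF m]]
      integrable_simple by blast
  have int: "integrable M (D (m + 1) i)" "integrable M (D m i)" "integrable M (Q i)" for i
    using m by (auto intro!: int_K D_K Q_K)
  have step: "(\<integral>\<omega>. (norm (anchored_diff (m + 1) i \<omega>))\<^sup>2 \<partial>M) \<le> (1 - p / 2) * (\<integral>\<omega>. (norm (anchored_diff m i \<omega>))\<^sup>2 \<partial>M)
      + (p + C) * (\<integral>\<omega>. D (m + 1) i \<omega> \<partial>M) + C * \<gamma>\<^sup>2 * (\<integral>\<omega>. D m i \<omega> \<partial>M)" for i
  proof -
    have "(\<integral>\<omega>. (norm (anchored_diff (m + 1) i \<omega>))\<^sup>2 \<partial>M) = (\<integral>\<omega>. (if c m \<omega> then D (m + 1) i \<omega> else Q i \<omega>) \<partial>M)"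
      by (rule Bochner_Integration.integral_cong)
        (auto simp: anchored_diff_def D_def Q_def w_step[OF m] scaleR_diff_left)
    also have "\<dots> = p * (\<integral>\<omega>. D (m + 1) i \<omega> \<partial>M) + (\<integral>\<omega>. (1 - p) * Q i \<omega> \<partial>M)"
      using p m by (subst coin_expectation[OF m _ _ D_K Q_K]) auto
    also have "(\<integral>\<omega>. (1 - p) * Q i \<omega> \<partial>M) \<le> (\<integral>\<omega>. (1 - p / 2) * (norm (anchored_diff m i \<omega>))\<^sup>2
        + C * (D (m + 1) i \<omega> + \<gamma>\<^sup>2 * D m i \<omega>) \<partial>M)"
    proof (rule integral_mono)
      show "integrable M (\<lambda>\<omega>. (1 - p) * Q i \<omega>)" by (rule integrable_mult_right[OF int(3)])
      show "integrable M (\<lambda>\<omega>. (1 - p / 2) * (norm (anchored_diff m i \<omega>))\<^sup>2 + C * (D (m + 1) i \<omega> + \<gamma>\<^sup>2 * D m i \<omega>))"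
        by (intro Bochner_Integration.integrable_add integrable_mult_right int int_diff)
      show "(1 - p) * Q i \<omega> \<le> (1 - p / 2) * (norm (anchored_diff m i \<omega>))\<^sup>2 + C * (D (m + 1) i \<omega> + \<gamma>\<^sup>2 * D m i \<omega>)" for \<omega>
        using stale_snapshot_bound[OF p, of "G i (x (m + 1) \<omega>)" \<gamma> "G i (x m \<omega>)" "G i (w m \<omega>)"
            "G i (x (m - 1) \<omega>)"]
        by (simp only: Q_def anchored_diff_def D_def C_def add_diff_cancel_right')
    qed
    also have "\<dots> = (1 - p / 2) * (\<integral>\<omega>. (norm (anchored_diff m i \<omega>))\<^sup>2 \<partial>M)
        + C * ((\<integral>\<omega>. D (m + 1) i \<omega> \<partial>M) + \<gamma>\<^sup>2 * (\<integral>\<omega>. D m i \<omega> \<partial>M))"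
      by (simp only: Bochner_Integration.integral_add integral_mult_right_zero
          Bochner_Integration.integrable_add integrable_mult_right int int_diff)
    finally show ?thesis by (simp add: algebra_simps)
  qed
  have \<Delta>: "\<Delta>_svrg M n b G \<gamma> x w k = 1 / (real n * real b) * (\<Sum>i\<in>{1..n}. \<integral>\<omega>. (norm (anchored_diff k i \<omega>))\<^sup>2 \<partial>M)"
    if "k \<ge> 0" for k
    using that by (simp add: \<Delta>_svrg_def anchored_diff_def)
  have U: "U_diff M n G x k = 1 / real n * (\<Sum>i\<in>{1..n}. \<integral>\<omega>. D k i \<omega> \<partial>M)" for k
    by (simp add: U_diff_def D_def)
  have "\<Delta>_svrg M n b G \<gamma> x w (m + 1) \<le> 1 / (real n * real b) *
      (\<Sum>i\<in>{1..n}. (1 - p / 2) * (\<integral>\<omega>. (norm (anchored_diff m i \<omega>))\<^sup>2 \<partial>M)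
      + (p + C) * (\<integral>\<omega>. D (m + 1) i \<omega> \<partial>M) + C * \<gamma>\<^sup>2 * (\<integral>\<omega>. D m i \<omega> \<partial>M))"
    using m by (subst \<Delta>) (simp, rule mult_left_mono[OF sum_mono[OF step]], simp)
  also have "\<dots> = 1 / (real n * real b) * ((1 - p / 2) * (\<Sum>i\<in>{1..n}. \<integral>\<omega>. (norm (anchored_diff m i \<omega>))\<^sup>2 \<partial>M)
      + (p + C) * (\<Sum>i\<in>{1..n}. \<integral>\<omega>. D (m + 1) i \<omega> \<partial>M) + C * \<gamma>\<^sup>2 * (\<Sum>i\<in>{1..n}. \<integral>\<omega>. D m i \<omega> \<partial>M))"
    by (simp only: sum.distrib sum_distrib_left)
  also have "\<dots> = (1 - p / 2) * \<Delta>_svrg M n b G \<gamma> x w m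
      + (p + C) / real b * U_diff M n G x (m + 1) + C * \<gamma>\<^sup>2 / real b * U_diff M n G x m"
  proof -
    have "1 / (real n * real b) * (a * A + d * A' + e * A'') = a * (1 / (real n * real b) * A)
        + d / real b * (1 / real n * A') + e / real b * (1 / real n * A'')" for a d e A A' A''
      by (simp add: algebra_simps add_divide_distrib)
    then show ?thesis unfolding \<Delta>[OF m] U .
  qed
  also have "p + C = (4 - 6 * p + 3 * p\<^sup>2) / p"
    using p by (simp add: C_def field_simps power2_eq_square)
  also have "C = 2 * (2 - 3 * p + p\<^sup>2) / p"
    using p by (simp add: C_def field_simps power2_eq_square)
  finally show ?thesis by (simp only: divide_divide_eq_left times_divide_eq_left times_divide_eq_right mult_ac)
qed

lemma \<Delta>_initial: "\<Delta>_svrg M n b G \<gamma> x w 0 = 0"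
proof -
  have "(\<integral>\<omega>. (norm (G i (x 0 \<omega>) - \<gamma> *\<^sub>R G i (x (0 - 1) \<omega>) - (1 - \<gamma>) *\<^sub>R G i (w 0 \<omega>)))\<^sup>2 \<partial>M)
      = (\<integral>\<omega>. 0 \<partial>M)" for i
    by (rule Bochner_Integration.integral_cong) (auto simp: init algebra_simps)
  then show ?thesis by (simp add: \<Delta>_svrg_def)
qed

text \<open>
  The three initial iterates and the first snapshot coincide, so both sides vanish.
\<close>

lemma \<Delta>_recursion_initial:
  assumes p: "0 < p" "p < 1"
  shows "\<Delta>_svrg M n b G \<gamma> x w 0 \<le> (1 - p / 2) * \<Delta>_svrg M n b G \<gamma> x w (0 - 1)
      + (4 - 6 * p + 3 * p\<^sup>2) / (real b * p) * U_diff M n G x 0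
      + 2 * \<gamma>\<^sup>2 * (2 - 3 * p + p\<^sup>2) / (real b * p) * U_diff M n G x (0 - 1)"
proof -
  have "U_diff M n G x k = 1 / real n * (\<Sum>i\<in>{1..n}. \<integral>\<omega>. 0 \<partial>M)" if "k = 0 \<or> k = -1" for k
    unfolding U_diff_def using that
    by (intro arg_cong2[where f = "(*)"] sum.cong Bochner_Integration.integral_cong refl)
      (auto simp: init)
  moreover have "\<Delta>_svrg M n b G \<gamma> x w (0 - 1) = 0" by (simp add: \<Delta>_svrg_def)
  ultimately show ?thesis by (simp add: \<Delta>_initial)
qed

end

theorem lemma2p2:
  fixes M :: "'a measure"
    and n b :: nat
    and G :: "nat \<Rightarrow> real^'d \<Rightarrow> real^'d"
    and \<gamma> p :: real
    and x0 :: "real^'d"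
    and \<Phi> :: "int \<Rightarrow> (real^'d) list \<Rightarrow> (real^'d) list \<Rightarrow> nat set list \<Rightarrow> bool list
                \<Rightarrow> (real^'d) list \<Rightarrow> real^'d"
    and x w :: "int \<Rightarrow> 'a \<Rightarrow> real^'d"
    and B :: "int \<Rightarrow> 'a \<Rightarrow> nat set"
    and c :: "int \<Rightarrow> 'a \<Rightarrow> bool"
  assumes "loopless_svrg M n b G \<gamma> p x0 \<Phi> x w B c"
    and "0 \<le> \<gamma>" and "\<gamma> \<le> 1"
    and "0 < p" and "p < 1"
  shows "unbiased_variance_reduced M n G \<gamma> x (S_svrg n b G \<gamma> x w B) (\<Delta>_svrg M n b G \<gamma> x w)
           (p / 2)
           ((4 - 6 * p + 3 * p\<^sup>2) / (real b * p))
           (2 * \<gamma>\<^sup>2 * (2 - 3 * p + p\<^sup>2) / (real b * p))"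
proof -
  interpret loopless_svrg M n b G \<gamma> p x0 \<Phi> x w B c by (rule assms(1))
  show ?thesis
    unfolding unbiased_variance_reduced_def
  proof (intro allI impI conjI)
    fix k :: int
    assume k: "0 \<le> k"
    show "integrable M (\<lambda>\<omega>. S_svrg n b G \<gamma> x w B k \<omega> - S_target n G \<gamma> x k \<omega>)"
      using integrable_batch_error[OF k, of "\<lambda>e. e"] by (simp add: estimation_error)
    show "AE \<omega> in M. vec_cond_exp M (iterate_algebra M x k)
        (\<lambda>\<omega>'. S_svrg n b G \<gamma> x w B k \<omega>' - S_target n G \<gamma> x k \<omega>') \<omega> = 0"
      by (rule svrg_unbiased[OF k])
    show "integrable M (\<lambda>\<omega>. (norm (S_svrg n b G \<gamma> x w B k \<omega> - S_target n G \<gamma> x k \<omega>))\<^sup>2)"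
      and "(\<integral>\<omega>. (norm (S_svrg n b G \<gamma> x w B k \<omega> - S_target n G \<gamma> x k \<omega>))\<^sup>2 \<partial>M)
        \<le> \<Delta>_svrg M n b G \<gamma> x w k"
      by (rule svrg_variance[OF k])+
    show "\<Delta>_svrg M n b G \<gamma> x w k \<le> (1 - p / 2) * \<Delta>_svrg M n b G \<gamma> x w (k - 1)
        + (4 - 6 * p + 3 * p\<^sup>2) / (real b * p) * U_diff M n G x k
        + 2 * \<gamma>\<^sup>2 * (2 - 3 * p + p\<^sup>2) / (real b * p) * U_diff M n G x (k - 1)"
    proof (cases "k = 0")
      case True
      show ?thesis unfolding True by (rule \<Delta>_recursion_initial[OF assms(4,5)])
    next
      case False
      then show ?thesis using \<Delta>_recursion[OF assms(4,5), of "k - 1"] k by simp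
    qed
  qed
qed

end
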